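(* Let $\mathbf S=(S,\wedge,0)$ be an atomic meet-semilattice with least element $0$, and let $\operatorname{At}\mathbf S$ denote the set of all atoms of $\mathbf S$. Then the lattice $\mathbf{Cl}(\mathbf S)=(\mathrm{Cl}(\mathbf S),\subseteq)$ of closed subsets of $S$ is isomorphic to the Boolean algebra $(2^{\operatorname{At}\mathbf S},\subseteq)$ of all subsets of $\operatorname{At}\mathbf S$.
   Context: For a meet-semilattice $\mathbf S=(S,\wedge,0)$ with least element $0$, the orthogonality relation on $S$ is defined by $x\perp y$ iff $x\wedge y=0$. For $A\subseteq S$ put $A^\perp:=\{x\in S\mid x\perp y\text{ for all }y\in A\}$. A subset $A\subseteq S$ is called closed if $A^{\perp\perp}=A$; $\mathrm{Cl}(\mathbf S)$ is the set of all closed subsets of $S$, ordered by inclusion. $\mathbf S$ is atomic if every nonzero element lies above some atom (an atom being a minimal element of $S\setminus\{0\}$). *)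

theory Defs
  imports Main
begin

text \<open>A meet-semilattice with least element is a type of sort
  \<open>{semilattice_inf, order_bot}\<close>: \<open>S\<close> is \<open>UNIV\<close>, \<open>\<and>\<close> is \<open>inf\<close> and \<open>0\<close> is \<open>bot\<close>.\<close>

definition orthogonal :: "'a::{semilattice_inf, order_bot} \<Rightarrow> 'a \<Rightarrow> bool"
  where "orthogonal x y \<longleftrightarrow> inf x y = bot"

definition perp :: "'a::{semilattice_inf, order_bot} set \<Rightarrow> 'a set"
  where "perp A = {x. \<forall>y\<in>A. orthogonal x y}"

definition Cl :: "'a::{semilattice_inf, order_bot} set set"
  where "Cl = {A. perp (perp A) = A}"

definition At :: "'a::{semilattice_inf, order_bot} set"
  where "At = {a. a \<noteq> bot \<and> (\<forall>x. x \<noteq> bot \<and> x \<le> a \<longrightarrow> x = a)}"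

definition order_isomorphism_betw :: "('a::order \<Rightarrow> 'b::order) \<Rightarrow> 'a set \<Rightarrow> 'b set \<Rightarrow> bool"
  where "order_isomorphism_betw f X Y \<longleftrightarrow>
    bij_betw f X Y \<and> (\<forall>x\<in>X. \<forall>y\<in>X. x \<le> y \<longleftrightarrow> f x \<le> f y)"

end

theory Submission
  imports Defs
begin

text \<open>In an atomic semilattice, two elements are orthogonal iff no atom lies below both, so
  \<open>perp A\<close> consists of the elements all of whose atoms avoid those below members of \<open>A\<close>.
  Hence the closed sets are exactly the sets of elements whose atoms all belong to a fixed
  set \<open>B\<close> of atoms, and \<open>B\<close> is recovered as the set of atoms in the closed set.\<close>

definition atoms_below :: "'a::{semilattice_inf, order_bot} \<Rightarrow> 'a set"
  where "atoms_below x = {a \<in> At. a \<le> x}"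

definition supported_on :: "'a::{semilattice_inf, order_bot} set \<Rightarrow> 'a set"
  where "supported_on B = {x. atoms_below x \<subseteq> B}"

lemma atoms_below_subset_At: "atoms_below x \<subseteq> At"
  by (auto simp: atoms_below_def)

lemma atoms_below_atom: "a \<in> At \<Longrightarrow> atoms_below a = {a}"
  by (auto simp: atoms_below_def At_def)

lemma supported_on_Int_At: "B \<subseteq> At \<Longrightarrow> supported_on B \<inter> At = B"
  by (auto simp: supported_on_def atoms_below_atom)

lemma supported_on_mono: "B \<subseteq> C \<Longrightarrow> supported_on B \<subseteq> supported_on C"
  by (auto simp: supported_on_def)

text \<open>Each \<open>b\<close> in \<open>B\<close> is an atom, hence its own only atom, so it
  witnesses itself in the union. This lets \<open>perp\<close> be iterated on sets of the form
  \<open>supported_on B\<close>.\<close>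

lemma UN_atoms_below_supported_on:
  assumes "B \<subseteq> At"
  shows "(\<Union>x\<in>supported_on B. atoms_below x) = B"
proof
  show "B \<subseteq> (\<Union>x\<in>supported_on B. atoms_below x)"
  proof
    fix b
    assume "b \<in> B"
    then have "atoms_below b = {b}" "b \<in> supported_on B"
      using assms by (auto simp: supported_on_def atoms_below_atom)
    then show "b \<in> (\<Union>x\<in>supported_on B. atoms_below x)"
      by blast
  qed
qed (auto simp: supported_on_def)

text \<open>A common atom would lie below \<open>inf x y\<close>, which rules out
  \<open>inf x y = bot\<close>; conversely, atomicity puts an atom below any nonzero
  \<open>inf x y\<close>.\<close>

lemma orthogonal_iff_disjoint_atoms:
  fixes x y :: "'a::{semilattice_inf, order_bot}"
  assumes "\<forall>x::'a. x \<noteq> bot \<longrightarrow> (\<exists>a\<in>At. a \<le> x)"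
  shows "orthogonal x y \<longleftrightarrow> atoms_below x \<inter> atoms_below y = {}"
proof
  assume "orthogonal x y"
  then have "a \<le> bot" if "a \<le> x" "a \<le> y" for a
    using that by (metis le_inf_iff orthogonal_def)
  then show "atoms_below x \<inter> atoms_below y = {}"
    by (auto simp: atoms_below_def At_def bot_unique)
next
  assume "atoms_below x \<inter> atoms_below y = {}"
  then have "\<not> (\<exists>a\<in>At. a \<le> inf x y)"
    by (auto simp: atoms_below_def)
  then show "orthogonal x y"
    using assms unfolding orthogonal_def by blast
qed

lemma perp_eq_supported_on:
  fixes A :: "'a::{semilattice_inf, order_bot} set"
  assumes "\<forall>x::'a. x \<noteq> bot \<longrightarrow> (\<exists>a\<in>At. a \<le> x)"
  shows "perp A = supported_on (At - (\<Union>x\<in>A. atoms_below x))"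
  using atoms_below_subset_At
  by (fastforce simp: perp_def supported_on_def orthogonal_iff_disjoint_atoms[OF assms])

text \<open>Each \<open>perp\<close> complements the set of occurring atoms within
  \<open>At\<close>, and two complements cancel.\<close>

lemma perp_perp_eq_supported_on:
  fixes A :: "'a::{semilattice_inf, order_bot} set"
  assumes "\<forall>x::'a. x \<noteq> bot \<longrightarrow> (\<exists>a\<in>At. a \<le> x)"
  shows "perp (perp A) = supported_on (\<Union>x\<in>A. atoms_below x)"
proof -
  have "(\<Union>x\<in>A. atoms_below x) \<subseteq> At"
    using atoms_below_subset_At by blast
  then show ?thesis
    by (simp add: perp_eq_supported_on[OF assms] UN_atoms_below_supported_on double_diff)
qed

text \<open>A closed set equals its double \<open>perp\<close>, so it is supported on its own atoms;
  conversely, the atoms occurring in \<open>supported_on B\<close> are exactly \<open>B\<close>, so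
  the double \<open>perp\<close> gives it back.\<close>

lemma Cl_eq_supported_on:
  assumes "\<forall>x::'a::{semilattice_inf, order_bot}. x \<noteq> bot \<longrightarrow> (\<exists>a\<in>At. a \<le> x)"
  shows "(Cl :: 'a set set) = supported_on ` Pow At"
proof
  show "(Cl :: 'a set set) \<subseteq> supported_on ` Pow At"
  proof
    fix A :: "'a set"
    assume "A \<in> Cl"
    then have "A = supported_on (\<Union>x\<in>A. atoms_below x)"
      by (simp add: Cl_def perp_perp_eq_supported_on[OF assms])
    moreover have "(\<Union>x\<in>A. atoms_below x) \<in> Pow At"
      using atoms_below_subset_At by blast
    ultimately show "A \<in> supported_on ` Pow At"
      by (rule image_eqI)
  qed
  show "supported_on ` Pow At \<subseteq> (Cl :: 'a set set)"
    by (auto simp: Cl_def perp_perp_eq_supported_on[OF assms] UN_atoms_below_supported_on)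
qed

theorem theorem1:
  assumes atomic: "\<forall>x::'a::{semilattice_inf, order_bot}. x \<noteq> bot \<longrightarrow> (\<exists>a\<in>At. a \<le> x)"
  shows "\<exists>f. order_isomorphism_betw f (Cl :: 'a set set) (Pow (At :: 'a set))"
proof
  \<comment> \<open>This makes \<open>supported_on\<close> the inverse of intersecting with
    \<open>At\<close>.\<close>
  have restrict: "supported_on (A \<inter> At) = A" if "A \<in> Cl" for A :: "'a set"
    using that by (auto simp: Cl_eq_supported_on[OF atomic] supported_on_Int_At)
  have "bij_betw (\<lambda>A. A \<inter> At) (Cl :: 'a set set) (Pow At)"
    by (rule bij_betw_byWitness[where f' = supported_on])
      (auto simp: restrict supported_on_Int_At Cl_eq_supported_on[OF atomic])
  \<comment> \<open>Order is reflected because the inverse \<open>supported_on\<close> is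
    monotone.\<close>
  moreover have "A \<subseteq> B \<longleftrightarrow> A \<inter> At \<subseteq> B \<inter> At" if "A \<in> Cl" "B \<in> Cl" for A B :: "'a set"
    using supported_on_mono[of "A \<inter> At" "B \<inter> At"] restrict that by auto
  ultimately show "order_isomorphism_betw (\<lambda>A. A \<inter> At) (Cl :: 'a set set) (Pow At)"
    by (simp add: order_isomorphism_betw_def)
qed

end
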